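(* The assignments $\mathbf A\mapsto\mathbf P_{\mathbf A}$, from idempotent residuated chains to enhanced monoidal preorders, and $\mathbf P\mapsto\mathbf A_{\mathbf P}$, from enhanced monoidal preorders to idempotent residuated chains, are inverses of each other: $\mathbf A_{\mathbf P_{\mathbf A}}=\mathbf A$ for every idempotent residuated chain $\mathbf A$, and $\mathbf P_{\mathbf A_{\mathbf P}}=\mathbf P$ for every enhanced monoidal preorder $\mathbf P$.
   Context: A residuated lattice is an algebra $(A,\wedge,\vee,\cdot,\backslash,/,1)$ such that $(A,\wedge,\vee)$ is a lattice, $(A,\cdot,1)$ is a monoid, and $y\le x\backslash z \iff x\cdot y\le z\iff x\le z/y$. An idempotent residuated chain is a residuated lattice whose order is total and which satisfies $x\cdot x=x$. For a preorder $\sqsubseteq$ write $x\sqsubset y$ if $x\sqsubseteq y$ and $y\not\sqsubseteq x$. An enhanced monoidal preorder is a structure $(P,\sqsubseteq,P^+,P^-,1,{}^\star)$ where $\sqsubseteq$ is a preorder on $P$ with $x\sqsubset 1$ for all $x\ne 1$; $P^+,P^-\subseteq P$ are subsets on each of which $\sqsubseteq$ restricts to a total order, with $P^+\cup P^-=P$ and $P^+\cap P^-=\{1\}$; and $^\star$ is a unary operation on $P$ with $1^\star=1$ such that: (1) for $1\ne b\in P^-$, $b^\star$ is the $\sqsubseteq$-smallest element $c$ of $P^+$ such that $b\sqsubset c$; (2) for $1\ne a\in P^+$, $a^\star$ is the $\sqsubseteq$-largest element $c$ of $P^-$ such that $c\sqsubset a$; (3) if two distinct elements $x,y$ satisfy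 neither $x\sqsubset y$ nor $y\sqsubset x$, then one of them lies in $P^+$ and the other in $P^-$, and $\{z:z\sqsubset x\}=\{z:z\sqsubset y\}$ and $\{z:x\sqsubset z\}=\{z:y\sqsubset z\}$. $\mathbf P_{\mathbf A}$: for an idempotent residuated chain $\mathbf A$, $\mathbf P_{\mathbf A}:=(A,\sqsubseteq,A^+,A^-,1,{}^\star)$ where $x\sqsubseteq y$ iff $xy=x$, $A^+=\{x:1\le x\}$, $A^-=\{x:x\le 1\}$, and $x^\star=(1/x)\wedge(x\backslash 1)$. $\mathbf A_{\mathbf P}$: for an enhanced monoidal preorder $\mathbf P$, $\mathbf A_{\mathbf P}$ has underlying set $P$, identity $1$, and order $x\le y$ iff ($x,y\in P^-$ and $x\sqsubseteq y$) or ($x,y\in P^+$ and $y\sqsubseteq x$) or ($x\in P^-$ and $y\in P^+$). Inverses are defined by: if every $y\ne x$ satisfies $x\sqsubset y$ or $y\sqsubset x$, then $x^\ell=x^r=x^\star$; for distinct $a\in P^+$, $b\in P^-$: if $a\sqsubseteq b$ and $b\sqsubseteq a$, then $a^\ell=b$, $a^r=a^\star$, $b^\ell=b^\star$, $b^r=a$; if $a,b$ are $\sqsubseteq$-incomparable, then $a^\ell=a^\star$, $a^r=b$, $b^\ell=a$, $b^r=b^\star$. The remaining operations are: $xy=x\wedge y$ if $x\le y^\ell$ and $xy=x\vee y$ if $y^\ell<x$; $x\backslash y=x^r\vee y$ if $x\le y$ and $x\backslash y=x^r\wedge y$ if $y<x$; $y/x=x^\ell\vee y$ if $x\le y$ and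 $y/x=x^\ell\wedge y$ if $y<x$. *)

theory Defs
  imports "HOL-Algebra.Group"
begin

text \<open>
  Structures live on a carrier set inside a type. So that equality of records is equality of
  structures, operations are required to be extensional (\<open>undefined\<close> off the carrier, via
  \<open>\<rightarrow>\<^sub>E\<close>), and relations and distinguished subsets to lie within the carrier. This only fixes the
  irrelevant values outside the carrier.
\<close>

section \<open>Idempotent residuated chains\<close>

text \<open>\<open>ldiv A x z\<close> is $x \backslash z$ and \<open>rdiv A z y\<close> is $z / y$.\<close>

record 'a residuated_lattice = "'a monoid" +
  rl_meet :: "'a \<Rightarrow> 'a \<Rightarrow> 'a" (infixl "\<^bold>\<and>\<index>" 65)
  rl_join :: "'a \<Rightarrow> 'a \<Rightarrow> 'a" (infixl "\<^bold>\<or>\<index>" 65)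
  ldiv :: "'a \<Rightarrow> 'a \<Rightarrow> 'a"
  rdiv :: "'a \<Rightarrow> 'a \<Rightarrow> 'a"

definition rl_le :: "('a, 'b) residuated_lattice_scheme \<Rightarrow> 'a \<Rightarrow> 'a \<Rightarrow> bool" (infix "\<preceq>\<index>" 50)
  where "x \<preceq>\<^bsub>A\<^esub> y \<longleftrightarrow> x \<^bold>\<and>\<^bsub>A\<^esub> y = x"

locale residuated_lattice = monoid A for A (structure) +
  assumes mult_ext: "mult A \<in> carrier A \<rightarrow>\<^sub>E carrier A \<rightarrow>\<^sub>E carrier A"
    and meet_ext: "rl_meet A \<in> carrier A \<rightarrow>\<^sub>E carrier A \<rightarrow>\<^sub>E carrier A"
    and join_ext: "rl_join A \<in> carrier A \<rightarrow>\<^sub>E carrier A \<rightarrow>\<^sub>E carrier A"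
    and ldiv_ext: "ldiv A \<in> carrier A \<rightarrow>\<^sub>E carrier A \<rightarrow>\<^sub>E carrier A"
    and rdiv_ext: "rdiv A \<in> carrier A \<rightarrow>\<^sub>E carrier A \<rightarrow>\<^sub>E carrier A"
    and meet_comm: "\<lbrakk>x \<in> carrier A; y \<in> carrier A\<rbrakk> \<Longrightarrow> x \<^bold>\<and> y = y \<^bold>\<and> x"
    and join_comm: "\<lbrakk>x \<in> carrier A; y \<in> carrier A\<rbrakk> \<Longrightarrow> x \<^bold>\<or> y = y \<^bold>\<or> x"
    and meet_assoc: "\<lbrakk>x \<in> carrier A; y \<in> carrier A; z \<in> carrier A\<rbrakk> \<Longrightarrow>
      (x \<^bold>\<and> y) \<^bold>\<and> z = x \<^bold>\<and> (y \<^bold>\<and> z)"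
    and join_assoc: "\<lbrakk>x \<in> carrier A; y \<in> carrier A; z \<in> carrier A\<rbrakk> \<Longrightarrow>
      (x \<^bold>\<or> y) \<^bold>\<or> z = x \<^bold>\<or> (y \<^bold>\<or> z)"
    and meet_join_absorb: "\<lbrakk>x \<in> carrier A; y \<in> carrier A\<rbrakk> \<Longrightarrow> x \<^bold>\<and> (x \<^bold>\<or> y) = x"
    and join_meet_absorb: "\<lbrakk>x \<in> carrier A; y \<in> carrier A\<rbrakk> \<Longrightarrow> x \<^bold>\<or> (x \<^bold>\<and> y) = x"
    and ldiv_residual: "\<lbrakk>x \<in> carrier A; y \<in> carrier A; z \<in> carrier A\<rbrakk> \<Longrightarrow>
      y \<preceq> ldiv A x z \<longleftrightarrow> x \<otimes> y \<preceq> z"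
    and rdiv_residual: "\<lbrakk>x \<in> carrier A; y \<in> carrier A; z \<in> carrier A\<rbrakk> \<Longrightarrow>
      x \<otimes> y \<preceq> z \<longleftrightarrow> x \<preceq> rdiv A z y"

locale idempotent_residuated_chain = residuated_lattice A for A (structure) +
  assumes le_total: "\<lbrakk>x \<in> carrier A; y \<in> carrier A\<rbrakk> \<Longrightarrow> x \<preceq> y \<or> y \<preceq> x"
    and mult_idem: "x \<in> carrier A \<Longrightarrow> x \<otimes> x = x"

section \<open>Enhanced monoidal preorders\<close>

record 'a enhanced_preorder = "'a partial_object" +
  prel :: "('a \<times> 'a) set"
  pos :: "'a set"
  neg :: "'a set"
  eunit :: 'a
  star :: "'a \<Rightarrow> 'a"

definition emp_le :: "('a, 'b) enhanced_preorder_scheme \<Rightarrow> 'a \<Rightarrow> 'a \<Rightarrow> bool" (infix "\<lesssim>\<index>" 50)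
  where "x \<lesssim>\<^bsub>P\<^esub> y \<longleftrightarrow> (x, y) \<in> prel P"

definition emp_less :: "('a, 'b) enhanced_preorder_scheme \<Rightarrow> 'a \<Rightarrow> 'a \<Rightarrow> bool" (infix "\<prec>\<index>" 50)
  where "x \<prec>\<^bsub>P\<^esub> y \<longleftrightarrow> x \<lesssim>\<^bsub>P\<^esub> y \<and> \<not> y \<lesssim>\<^bsub>P\<^esub> x"

locale enhanced_monoidal_preorder =
  fixes P (structure)
  assumes preorder: "preorder_on (carrier P) (prel P)"
    and unit_closed: "eunit P \<in> carrier P"
    and less_unit: "\<lbrakk>x \<in> carrier P; x \<noteq> eunit P\<rbrakk> \<Longrightarrow> x \<prec> eunit P"
    and pos_linear: "linear_order_on (pos P) (Restr (prel P) (pos P))"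
    and neg_linear: "linear_order_on (neg P) (Restr (prel P) (neg P))"
    and pos_Un_neg: "pos P \<union> neg P = carrier P"
    and pos_Int_neg: "pos P \<inter> neg P = {eunit P}"
    and star_ext: "star P \<in> carrier P \<rightarrow>\<^sub>E carrier P"
    and star_unit: "star P (eunit P) = eunit P"
    and star_neg: "\<lbrakk>b \<in> neg P; b \<noteq> eunit P\<rbrakk> \<Longrightarrow>
      star P b \<in> pos P \<and> b \<prec> star P b \<and> (\<forall>c\<in>pos P. b \<prec> c \<longrightarrow> star P b \<lesssim> c)"
    and star_pos: "\<lbrakk>a \<in> pos P; a \<noteq> eunit P\<rbrakk> \<Longrightarrow>
      star P a \<in> neg P \<and> star P a \<prec> a \<and> (\<forall>c\<in>neg P. c \<prec> a \<longrightarrow> c \<lesssim> star P a)"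
    and unrelated: "\<lbrakk>x \<in> carrier P; y \<in> carrier P; x \<noteq> y; \<not> x \<prec> y; \<not> y \<prec> x\<rbrakk> \<Longrightarrow>
      (x \<in> pos P \<and> y \<in> neg P \<or> x \<in> neg P \<and> y \<in> pos P) \<and>
      {z \<in> carrier P. z \<prec> x} = {z \<in> carrier P. z \<prec> y} \<and>
      {z \<in> carrier P. x \<prec> z} = {z \<in> carrier P. y \<prec> z}"

section \<open>From chains to preorders\<close>

definition P_of :: "'a residuated_lattice \<Rightarrow> 'a enhanced_preorder"
  where "P_of A = \<lparr>
    carrier = carrier A,
    prel = {(x, y). x \<in> carrier A \<and> y \<in> carrier A \<and> x \<otimes>\<^bsub>A\<^esub> y = x},
    pos = {x \<in> carrier A. \<one>\<^bsub>A\<^esub> \<preceq>\<^bsub>A\<^esub> x},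
    neg = {x \<in> carrier A. x \<preceq>\<^bsub>A\<^esub> \<one>\<^bsub>A\<^esub>},
    eunit = \<one>\<^bsub>A\<^esub>,
    star = (\<lambda>x\<in>carrier A. rdiv A \<one>\<^bsub>A\<^esub> x \<^bold>\<and>\<^bsub>A\<^esub> ldiv A x \<one>\<^bsub>A\<^esub>)\<rparr>"

section \<open>From preorders to chains\<close>

definition chain_le :: "'a enhanced_preorder \<Rightarrow> 'a \<Rightarrow> 'a \<Rightarrow> bool"
  where "chain_le P x y \<longleftrightarrow>
    x \<in> neg P \<and> y \<in> neg P \<and> x \<lesssim>\<^bsub>P\<^esub> y \<or>
    x \<in> pos P \<and> y \<in> pos P \<and> y \<lesssim>\<^bsub>P\<^esub> x \<or>
    x \<in> neg P \<and> y \<in> pos P"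

text \<open>
  Since \<^const>\<open>chain_le\<close> is total, its meets and joins are minima and maxima. For the same reason
  the negation of \<open>chain_le P x y\<close> below stands for $y < x$.
\<close>

definition chain_meet :: "'a enhanced_preorder \<Rightarrow> 'a \<Rightarrow> 'a \<Rightarrow> 'a"
  where "chain_meet P x y = (if chain_le P x y then x else y)"

definition chain_join :: "'a enhanced_preorder \<Rightarrow> 'a \<Rightarrow> 'a \<Rightarrow> 'a"
  where "chain_join P x y = (if chain_le P x y then y else x)"

text \<open>
  By axiom \<open>unrelated\<close> an element has at most one partner, and it lies in the part (positive or
  negative) not containing the element. Two partners are either equivalent or incomparable.
\<close>

definition is_partner :: "'a enhanced_preorder \<Rightarrow> 'a \<Rightarrow> 'a \<Rightarrow> bool"
  where "is_partner P x y \<longleftrightarrow> y \<in> carrier P \<and> y \<noteq> x \<and> \<not> x \<prec>\<^bsub>P\<^esub> y \<and> \<not> y \<prec>\<^bsub>P\<^esub> x"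

definition left_inv :: "'a enhanced_preorder \<Rightarrow> 'a \<Rightarrow> 'a"
  where "left_inv P x =
    (if \<exists>y. is_partner P x y then
       let y = (THE y. is_partner P x y) in
       if x \<in> pos P then (if x \<lesssim>\<^bsub>P\<^esub> y \<and> y \<lesssim>\<^bsub>P\<^esub> x then y else star P x)
       else (if x \<lesssim>\<^bsub>P\<^esub> y \<and> y \<lesssim>\<^bsub>P\<^esub> x then star P x else y)
     else star P x)"

definition right_inv :: "'a enhanced_preorder \<Rightarrow> 'a \<Rightarrow> 'a"
  where "right_inv P x =
    (if \<exists>y. is_partner P x y then
       let y = (THE y. is_partner P x y) in
       if x \<in> pos P then (if x \<lesssim>\<^bsub>P\<^esub> y \<and> y \<lesssim>\<^bsub>P\<^esub> x then star P x else y)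
       else (if x \<lesssim>\<^bsub>P\<^esub> y \<and> y \<lesssim>\<^bsub>P\<^esub> x then y else star P x)
     else star P x)"

definition A_of :: "'a enhanced_preorder \<Rightarrow> 'a residuated_lattice"
  where "A_of P = \<lparr>
    carrier = carrier P,
    mult = (\<lambda>x\<in>carrier P. \<lambda>y\<in>carrier P.
      if chain_le P x (left_inv P y) then chain_meet P x y else chain_join P x y),
    one = eunit P,
    rl_meet = (\<lambda>x\<in>carrier P. \<lambda>y\<in>carrier P. chain_meet P x y),
    rl_join = (\<lambda>x\<in>carrier P. \<lambda>y\<in>carrier P. chain_join P x y),
    ldiv = (\<lambda>x\<in>carrier P. \<lambda>y\<in>carrier P.
      if chain_le P x y then chain_join P (right_inv P x) y else chain_meet P (right_inv P x) y),
    rdiv = (\<lambda>y\<in>carrier P. \<lambda>x\<in>carrier P.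
      if chain_le P x y then chain_join P (left_inv P x) y else chain_meet P (left_inv P x) y)\<rparr>"

end

theory Submission
  imports Defs
begin

text \<open>
  Both structures are encoded in the product. On an idempotent residuated chain \<open>x \<otimes> y\<close> is always one
  of \<open>x\<close>, \<open>y\<close>, so \<open>x \<otimes> y\<close> is \<open>x\<close> if \<open>x \<lesssim> y\<close> and \<open>y\<close> otherwise. On a preorder this formula defines an
  associative operation, and the inverses satisfy
  \<open>x \<le> y\<^sup>l \<longleftrightarrow> x \<bullet> y \<le> 1 \<longleftrightarrow> y \<le> x\<^sup>r\<close>; residuation and the agreement with the given multiplication then
  follow from totality alone. A residuated lattice is determined by its order and multiplication, so
  the divisions need not be compared when going from a chain to its preorder and back.
\<close>

section \<open>The chain of an enhanced monoidal preorder\<close>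

text \<open>Fixes the record type without extension fields, the only type on which
  \<open>chain_le\<close> and \<open>A_of\<close> are defined.\<close>

locale preorder_to_chain = enhanced_monoidal_preorder P for P :: "'a enhanced_preorder" (structure)
begin

abbreviation le (infix "\<unlhd>" 50) where "x \<unlhd> y \<equiv> chain_le P x y"

text \<open>A left-biased minimum: of two equivalent elements it returns the left one, of two
  incomparable elements the right one. It avoids the inverses through which the multiplication of
  \<open>A_of P\<close> is given, so associativity and the unit laws can be checked on
  \<open>\<lesssim>\<close> directly.\<close>

definition prod :: "'a \<Rightarrow> 'a \<Rightarrow> 'a" (infixl "\<bullet>" 70)
  where "x \<bullet> y = (if x \<lesssim> y then x else y)"

section \<open>The preorder and its two totally ordered parts\<close>

lemma carrier_iff: "x \<in> carrier P \<longleftrightarrow> x \<in> pos P \<or> x \<in> neg P"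
  using pos_Un_neg by blast

lemma pos_neg_unit: "x \<in> pos P \<Longrightarrow> x \<in> neg P \<longleftrightarrow> x = eunit P"
  using pos_Int_neg by blast

lemma unit_pos: "eunit P \<in> pos P" and unit_neg: "eunit P \<in> neg P"
  using pos_Int_neg by blast+

lemma rel_closed: "x \<lesssim> y \<Longrightarrow> x \<in> carrier P \<and> y \<in> carrier P"
  using preorder unfolding preorder_on_def refl_on_def emp_le_def by blast

lemma rel_refl: "x \<in> carrier P \<Longrightarrow> x \<lesssim> x"
  using preorder unfolding preorder_on_def refl_on_def emp_le_def by blast

lemma rel_trans: "x \<lesssim> y \<Longrightarrow> y \<lesssim> z \<Longrightarrow> x \<lesssim> z"
  using preorder unfolding preorder_on_def trans_def emp_le_def by blast

lemma pos_total: "x \<in> pos P \<Longrightarrow> y \<in> pos P \<Longrightarrow> x \<lesssim> y \<or> y \<lesssim> x"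
  using pos_linear rel_refl[of x] carrier_iff[of x]
  unfolding linear_order_on_def total_on_def emp_le_def by (cases "x = y") auto

lemma pos_antisym: "x \<in> pos P \<Longrightarrow> y \<in> pos P \<Longrightarrow> x \<lesssim> y \<Longrightarrow> y \<lesssim> x \<Longrightarrow> x = y"
  using pos_linear unfolding order_on_defs antisym_def emp_le_def by blast

lemma neg_total: "x \<in> neg P \<Longrightarrow> y \<in> neg P \<Longrightarrow> x \<lesssim> y \<or> y \<lesssim> x"
  using neg_linear rel_refl[of x] carrier_iff[of x]
  unfolding linear_order_on_def total_on_def emp_le_def by (cases "x = y") auto

lemma neg_antisym: "x \<in> neg P \<Longrightarrow> y \<in> neg P \<Longrightarrow> x \<lesssim> y \<Longrightarrow> y \<lesssim> x \<Longrightarrow> x = y"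
  using neg_linear unfolding order_on_defs antisym_def emp_le_def by blast

lemma rel_unit: "x \<in> carrier P \<Longrightarrow> x \<lesssim> eunit P"
  using less_unit rel_refl unfolding emp_less_def by blast

lemma unit_rel: "eunit P \<lesssim> x \<Longrightarrow> x = eunit P"
  using less_unit rel_closed unfolding emp_less_def by blast

section \<open>The total order of the chain\<close>

lemma le_refl: "x \<in> carrier P \<Longrightarrow> x \<unlhd> x"
  using rel_refl carrier_iff unfolding chain_le_def by blast

lemma le_total: "x \<in> carrier P \<Longrightarrow> y \<in> carrier P \<Longrightarrow> x \<unlhd> y \<or> y \<unlhd> x"
  using pos_total neg_total carrier_iff unfolding chain_le_def by blast

text \<open>Inside one part this is antisymmetry of \<open>\<lesssim>\<close>. In the mixed cases
  some element lies in both parts, hence is the unit, and \<open>unit_rel\<close> makes the other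
  one the unit as well.\<close>

lemma le_antisym: "x \<unlhd> y \<Longrightarrow> y \<unlhd> x \<Longrightarrow> x = y"
  using pos_antisym neg_antisym pos_neg_unit unit_rel unfolding chain_le_def by metis

lemma le_trans: "x \<unlhd> y \<Longrightarrow> y \<unlhd> z \<Longrightarrow> x \<unlhd> z"
  using rel_trans[of x y z] rel_trans[of z y x] pos_neg_unit[of y] unit_rel[of x] unit_rel[of z]
    unit_pos unit_neg unfolding chain_le_def by auto

lemma neg_iff: "x \<in> carrier P \<Longrightarrow> x \<in> neg P \<longleftrightarrow> x \<unlhd> eunit P"
  using unit_neg unit_pos unit_rel carrier_iff unfolding chain_le_def by metis

lemma pos_iff: "x \<in> carrier P \<Longrightarrow> x \<in> pos P \<longleftrightarrow> eunit P \<unlhd> x"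
  using unit_neg unit_pos unit_rel carrier_iff unfolding chain_le_def by metis

section \<open>Partners\<close>

lemma partner_cases:
  assumes "x \<in> carrier P" "is_partner P x y"
  shows "y \<in> carrier P" "x \<noteq> y" "x \<noteq> eunit P" "y \<noteq> eunit P" "x \<in> pos P \<longleftrightarrow> y \<in> neg P"
    "x \<in> neg P \<longleftrightarrow> y \<in> pos P" "x \<lesssim> y \<longleftrightarrow> y \<lesssim> x"
    "z \<prec> x \<longleftrightarrow> z \<prec> y" "x \<prec> z \<longleftrightarrow> y \<prec> z"
proof -
  show y: "y \<in> carrier P" and "x \<noteq> y" "x \<lesssim> y \<longleftrightarrow> y \<lesssim> x"
    using assms unfolding is_partner_def emp_less_def by auto
  \<comment> \<open>Every other element is strictly below the unit, so the unit neither has nor is a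
    partner.\<close>
  show u: "x \<noteq> eunit P" "y \<noteq> eunit P"
    using assms less_unit[of y] less_unit[of x] unfolding is_partner_def by auto
  note un = unrelated[OF assms(1) y]
  show "x \<in> pos P \<longleftrightarrow> y \<in> neg P" "x \<in> neg P \<longleftrightarrow> y \<in> pos P"
    using un u assms pos_neg_unit unfolding is_partner_def by metis+
  have sets: "{z \<in> carrier P. z \<prec> x} = {z \<in> carrier P. z \<prec> y}"
    "{z \<in> carrier P. x \<prec> z} = {z \<in> carrier P. y \<prec> z}"
    using un assms unfolding is_partner_def by auto
  show "z \<prec> x \<longleftrightarrow> z \<prec> y" using sets(1) rel_closed unfolding emp_less_def by blast
  show "x \<prec> z \<longleftrightarrow> y \<prec> z" using sets(2) rel_closed unfolding emp_less_def by blast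
qed

text \<open>Two partners of \<open>x\<close> lie in the same part, so if distinct they are strictly
  comparable. Since \<open>x\<close> and its partner \<open>y\<close> have the same elements
  strictly above and below them, \<open>x\<close> would then be strictly comparable to
  \<open>z\<close>.\<close>

lemma partner_unique:
  assumes x: "x \<in> carrier P" and y: "is_partner P x y" and z: "is_partner P x z"
  shows "y = z"
proof (rule ccontr)
  assume "y \<noteq> z"
  moreover note py = partner_cases[OF x y] and pz = partner_cases[OF x z]
  have "y \<in> pos P \<and> z \<in> pos P \<or> y \<in> neg P \<and> z \<in> neg P"
    using py pz x carrier_iff by blast
  ultimately have "y \<prec> z \<or> z \<prec> y"
    using pos_total neg_total pos_antisym neg_antisym unfolding emp_less_def by blast
  then show False
    using py pz y z unfolding is_partner_def by blast
qed

lemma the_partner: "x \<in> carrier P \<Longrightarrow> is_partner P x y \<Longrightarrow> (THE y. is_partner P x y) = y"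
  using partner_unique by blast

section \<open>Left and right inverses\<close>

lemma left_inv_no_partner: "\<not> (\<exists>y. is_partner P x y) \<Longrightarrow> left_inv P x = star P x"
  and right_inv_no_partner: "\<not> (\<exists>y. is_partner P x y) \<Longrightarrow> right_inv P x = star P x"
  unfolding left_inv_def right_inv_def by (simp_all only: if_False)

text \<open>One comparison between partners already separates equivalent from incomparable, which
  collapses the nested case split into a single test. The right inverse obeys the same test with the
  outcomes exchanged, so exactly one of the two inverses is the partner and the other is the
  star.\<close>

lemma left_inv_partner:
  assumes "x \<in> carrier P" "is_partner P x y"
  shows "left_inv P x = (if x \<in> pos P \<longleftrightarrow> x \<lesssim> y then y else star P x)"
  using partner_cases(7)[OF assms] assms(2)
  unfolding left_inv_def the_partner[OF assms] Let_def by auto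

lemma right_inv_partner:
  assumes "x \<in> carrier P" "is_partner P x y"
  shows "right_inv P x = (if x \<in> pos P \<longleftrightarrow> x \<lesssim> y then star P x else y)"
  using partner_cases(7)[OF assms] assms(2)
  unfolding right_inv_def the_partner[OF assms] Let_def by auto

lemma inv_cases:
  assumes "x \<in> carrier P"
  obtains "left_inv P x = star P x" "right_inv P x = star P x"
  | y where "is_partner P x y" "left_inv P x = y" "right_inv P x = star P x"
  | y where "is_partner P x y" "left_inv P x = star P x" "right_inv P x = y"
  using assms left_inv_no_partner[of x] right_inv_no_partner[of x] left_inv_partner right_inv_partner
  by (metis (full_types))

lemma unit_no_partner: "\<not> is_partner P (eunit P) y"
  using less_unit unfolding is_partner_def by auto

lemma inv_unit: "left_inv P (eunit P) = eunit P" "right_inv P (eunit P) = eunit P"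
  using unit_no_partner star_unit left_inv_no_partner[of "eunit P"] right_inv_no_partner[of "eunit P"] by simp_all

text \<open>The unit can be the star of a negative element, but not of a positive \<open>a\<close>
  other than the unit: \<open>star P a\<close> is strictly below \<open>a\<close>, and the unit is
  strictly below nothing.\<close>

lemma star_pos_nonunit: "a \<in> pos P \<Longrightarrow> a \<noteq> eunit P \<Longrightarrow> star P a \<in> neg P - {eunit P}"
  using star_pos[of a] unit_rel[of a] unfolding emp_less_def by auto

lemma inv_neg:
  assumes "b \<in> neg P"
  shows "left_inv P b \<in> pos P" "right_inv P b \<in> pos P"
proof -
  have b: "b \<in> carrier P" using assms carrier_iff by blast
  have "star P b \<in> pos P"
    using star_neg[OF assms] star_unit unit_pos by (cases "b = eunit P") auto
  then show "left_inv P b \<in> pos P" "right_inv P b \<in> pos P"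
    using assms by (cases rule: inv_cases[OF b]; simp add: partner_cases(6)[OF b, symmetric])+
qed

lemma inv_pos:
  assumes "a \<in> pos P" "a \<noteq> eunit P"
  shows "left_inv P a \<in> neg P - {eunit P}" "right_inv P a \<in> neg P - {eunit P}"
proof -
  have a: "a \<in> carrier P" using assms carrier_iff by blast
  show "left_inv P a \<in> neg P - {eunit P}" "right_inv P a \<in> neg P - {eunit P}"
    using star_pos_nonunit[OF assms] assms
    by (cases rule: inv_cases[OF a]; simp add: partner_cases(4)[OF a] partner_cases(5)[OF a, symmetric])+
qed

lemma inv_closed:
  assumes "x \<in> carrier P"
  shows "left_inv P x \<in> carrier P" "right_inv P x \<in> carrier P"
  using assms inv_neg inv_pos inv_unit unit_closed carrier_iff[of x]
    carrier_iff[of "left_inv P x"] carrier_iff[of "right_inv P x"]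
  by (cases "x = eunit P"; auto)+

lemma less_cases:
  assumes "x \<in> carrier P" "y \<in> carrier P"
  obtains "x = y" | "x \<prec> y" | "y \<prec> x" | "is_partner P x y"
  using assms unfolding is_partner_def by blast

text \<open>The left inverse of \<open>b\<close> is the \<open>\<lesssim>\<close>-least positive
  element not below \<open>b\<close>. Such elements are those strictly above \<open>b\<close>, of
  which the star is the least, and possibly a partner incomparable to \<open>b\<close>; that partner
  lies below all the others because it has the same strict upper set as \<open>b\<close>.\<close>

lemma left_inv_neg_iff:
  assumes b: "b \<in> neg P" "b \<noteq> eunit P" and x: "x \<in> pos P" "x \<noteq> eunit P"
  shows "left_inv P b \<lesssim> x \<longleftrightarrow> \<not> x \<lesssim> b"
proof -
  have bc: "b \<in> carrier P" and xc: "x \<in> carrier P" using b x carrier_iff by auto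
  have bn: "b \<notin> pos P" using b pos_neg_unit by blast
  show ?thesis
  proof (cases "left_inv P b = star P b")
    case True
    have "b \<prec> x" if "\<not> x \<lesssim> b"
      using bc xc
    proof (cases rule: less_cases)
      case 4
      \<comment> \<open>An incomparable partner would be the left inverse, which is the star here
        and therefore strictly above \<open>b\<close>.\<close>
      then have "x = star P b" using left_inv_partner[OF bc 4] bn that True partner_cases[OF bc 4] by auto
      then show ?thesis using star_neg[OF b] by simp
    qed (use that bn x in \<open>auto simp: emp_less_def\<close>)
    then show ?thesis using True star_neg[OF b] x rel_trans unfolding emp_less_def by metis
  next
    case False
    then obtain a where a: "is_partner P b a" using left_inv_no_partner by blast
    then have l: "left_inv P b = a" "\<not> b \<lesssim> a"
      using False left_inv_partner[OF bc a] bn by (auto split: if_splits)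
    note pa = partner_cases[OF bc a]
    have "a \<lesssim> x" if "\<not> x \<lesssim> b"
      using bc xc
    proof (cases rule: less_cases)
      case 2
      then show ?thesis using pa unfolding emp_less_def by blast
    next
      case 4
      then show ?thesis using partner_unique[OF bc a] pa rel_refl by auto
    qed (use that bn x in \<open>auto simp: emp_less_def\<close>)
    then show ?thesis using l pa rel_trans by metis
  qed
qed

text \<open>The right inverse of \<open>b\<close> is the \<open>\<lesssim>\<close>-least positive
  element weakly above \<open>b\<close>: an equivalent partner if there is one, otherwise the
  star.\<close>

lemma right_inv_neg_iff:
  assumes b: "b \<in> neg P" "b \<noteq> eunit P" and x: "x \<in> pos P" "x \<noteq> eunit P"
  shows "right_inv P b \<lesssim> x \<longleftrightarrow> b \<lesssim> x"
proof -
  have bc: "b \<in> carrier P" and xc: "x \<in> carrier P" using b x carrier_iff by auto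
  have bn: "b \<notin> pos P" using b pos_neg_unit by blast
  show ?thesis
  proof (cases "right_inv P b = star P b")
    case True
    have "b \<prec> x" if "b \<lesssim> x"
      using bc xc
    proof (cases rule: less_cases)
      case 4
      then have "x = star P b" using right_inv_partner[OF bc 4] bn that True by auto
      then show ?thesis using star_neg[OF b] by simp
    qed (use that bn x in \<open>auto simp: emp_less_def\<close>)
    then show ?thesis using True star_neg[OF b] x rel_trans unfolding emp_less_def by metis
  next
    case False
    then obtain a where a: "is_partner P b a" using right_inv_no_partner by blast
    then have l: "right_inv P b = a" "b \<lesssim> a"
      using False right_inv_partner[OF bc a] bn by (auto split: if_splits)
    note pa = partner_cases[OF bc a]
    have "a \<lesssim> x" if "b \<lesssim> x"
      using pa l that rel_trans by metis
    then show ?thesis using l rel_trans by metis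
  qed
qed

text \<open>Order dual of the previous situation: the left inverse of \<open>a\<close> is the
  \<open>\<lesssim>\<close>-largest negative element weakly below \<open>a\<close>, an equivalent
  partner if there is one and otherwise the star.\<close>

lemma left_inv_pos_iff:
  assumes a: "a \<in> pos P" "a \<noteq> eunit P" and x: "x \<in> neg P"
  shows "x \<lesssim> left_inv P a \<longleftrightarrow> x \<lesssim> a"
proof -
  have ac: "a \<in> carrier P" and xc: "x \<in> carrier P" using a x carrier_iff by auto
  have an: "a \<notin> neg P" using a pos_neg_unit by blast
  show ?thesis
  proof (cases "left_inv P a = star P a")
    case True
    have "x \<prec> a" if "x \<lesssim> a"
      using ac xc
    proof (cases rule: less_cases)
      case 4
      then have "x = star P a"
        using left_inv_partner[OF ac 4] a that True partner_cases[OF ac 4] by auto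
      then show ?thesis using star_pos[OF a] by simp
    qed (use that an x in \<open>auto simp: emp_less_def\<close>)
    then show ?thesis using True star_pos[OF a] x rel_trans unfolding emp_less_def by metis
  next
    case False
    then obtain b where b: "is_partner P a b" using left_inv_no_partner by blast
    then have l: "left_inv P a = b" "a \<lesssim> b"
      using False left_inv_partner[OF ac b] a by (auto split: if_splits)
    note pa = partner_cases[OF ac b]
    show ?thesis using l pa rel_trans by metis
  qed
qed

text \<open>The right inverse of \<open>a\<close> is the \<open>\<lesssim>\<close>-largest negative
  element not above \<open>a\<close>: an incomparable partner if there is one, otherwise the
  star.\<close>

lemma right_inv_pos_iff:
  assumes a: "a \<in> pos P" "a \<noteq> eunit P" and x: "x \<in> neg P"
  shows "x \<lesssim> right_inv P a \<longleftrightarrow> \<not> a \<lesssim> x"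
proof -
  have ac: "a \<in> carrier P" and xc: "x \<in> carrier P" using a x carrier_iff by auto
  have an: "a \<notin> neg P" using a pos_neg_unit by blast
  show ?thesis
  proof (cases "right_inv P a = star P a")
    case True
    have "x \<prec> a" if "\<not> a \<lesssim> x"
      using ac xc
    proof (cases rule: less_cases)
      case 4
      then have "x = star P a"
        using right_inv_partner[OF ac 4] a that True by auto
      then show ?thesis using star_pos[OF a] by simp
    qed (use that an x in \<open>auto simp: emp_less_def\<close>)
    then show ?thesis using True star_pos[OF a] x rel_trans unfolding emp_less_def by metis
  next
    case False
    then obtain b where b: "is_partner P a b" using right_inv_no_partner by blast
    then have l: "right_inv P a = b" "\<not> a \<lesssim> b"
      using False right_inv_partner[OF ac b] a by (auto split: if_splits)
    note pa = partner_cases[OF ac b]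
    have "x \<lesssim> b" if "\<not> a \<lesssim> x"
      using ac xc
    proof (cases rule: less_cases)
      case 3
      then show ?thesis using pa unfolding emp_less_def by blast
    next
      case 4
      then show ?thesis using partner_unique[OF ac b] pa rel_refl by auto
    qed (use that an x in \<open>auto simp: emp_less_def\<close>)
    then show ?thesis using l rel_trans by metis
  qed
qed

section \<open>The product and its residuation\<close>

lemma prod_closed: "x \<in> carrier P \<Longrightarrow> y \<in> carrier P \<Longrightarrow> x \<bullet> y \<in> carrier P"
  unfolding prod_def by simp

lemma prod_unit: "x \<in> carrier P \<Longrightarrow> x \<bullet> eunit P = x" "x \<in> carrier P \<Longrightarrow> eunit P \<bullet> x = x"
  unfolding prod_def using unit_rel rel_unit by auto

text \<open>If both factors lie in the same part, the parts alone decide both sides. If they lie in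
  opposite parts, \<open>left_inv_neg_iff\<close> and \<open>left_inv_pos_iff\<close> tell which
  factor \<open>\<bullet>\<close> selects, and its sign is the sign of the product.\<close>

lemma le_left_inv_iff:
  assumes x: "x \<in> carrier P" and y: "y \<in> carrier P"
  shows "x \<unlhd> left_inv P y \<longleftrightarrow> x \<bullet> y \<in> neg P"
proof -
  consider "y = eunit P" | "y \<in> neg P" "y \<noteq> eunit P" | "y \<in> pos P" "y \<noteq> eunit P"
    using y carrier_iff by blast
  then show ?thesis
  proof cases
    case 1
    then show ?thesis using x prod_unit inv_unit neg_iff by simp
  next
    case 2
    then show ?thesis
      using left_inv_neg_iff[OF 2, of x] inv_neg[OF 2(1)] x carrier_iff pos_neg_unit
      unfolding chain_le_def prod_def by metis
  next
    case 3
    \<comment> \<open>For positive \<open>x\<close> the product is not negative, so the inequality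
      has to fail; this is where the inverse being different from the unit enters.\<close>
    then show ?thesis
      using left_inv_pos_iff[OF 3, of x] inv_pos[OF 3] x carrier_iff pos_neg_unit unit_neg
      unfolding chain_le_def prod_def by (metis Diff_iff singletonI)
  qed
qed

lemma le_right_inv_iff:
  assumes x: "x \<in> carrier P" and y: "y \<in> carrier P"
  shows "y \<unlhd> right_inv P x \<longleftrightarrow> x \<bullet> y \<in> neg P"
proof -
  consider "x = eunit P" | "x \<in> neg P" "x \<noteq> eunit P" | "x \<in> pos P" "x \<noteq> eunit P"
    using x carrier_iff by blast
  then show ?thesis
  proof cases
    case 1
    then show ?thesis using y prod_unit inv_unit neg_iff by simp
  next
    case 2
    then show ?thesis
      using right_inv_neg_iff[OF 2, of y] inv_neg[OF 2(1)] y carrier_iff pos_neg_unit rel_unit[OF x]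
      unfolding chain_le_def prod_def by metis
  next
    case 3
    then show ?thesis
      using right_inv_pos_iff[OF 3, of y] inv_pos[OF 3] y carrier_iff pos_neg_unit unit_neg
      unfolding chain_le_def prod_def by (metis Diff_iff singletonI)
  qed
qed

text \<open>The chain order is \<open>\<lesssim>\<close> on the negative part and its reverse on the
  positive part, so the \<open>\<lesssim>\<close>-smaller factor is the meet in the former and the
  join in the latter. For factors of opposite sign, the sign of the product identifies the factor
  selected.\<close>

lemma prod_meet_or_join:
  assumes x: "x \<in> carrier P" and y: "y \<in> carrier P"
  shows "x \<bullet> y = (if x \<bullet> y \<in> neg P then chain_meet P x y else chain_join P x y)"
proof -
  \<comment> \<open>The unit lies in both parts: next to a negative factor it falls under the first
    case, next to a positive factor other than the unit under the second or third.\<close>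
  consider "x \<in> neg P" "y \<in> neg P" | "x \<in> pos P" "y \<in> pos P" "x \<notin> neg P" |
    "x \<in> pos P" "y \<in> pos P" "y \<notin> neg P" | "x \<in> neg P" "x \<notin> pos P" "y \<in> pos P" "y \<notin> neg P"
    | "x \<in> pos P" "x \<notin> neg P" "y \<in> neg P" "y \<notin> pos P"
    using x y carrier_iff by blast
  then show ?thesis
    using rel_unit x y
    by cases (auto simp: prod_def chain_meet_def chain_join_def chain_le_def pos_neg_unit
        dest: unit_rel rel_unit pos_antisym pos_total)
qed

lemma prod_eq_left:
  "x \<in> carrier P \<Longrightarrow> y \<in> carrier P \<Longrightarrow>
    x \<bullet> y = (if x \<unlhd> left_inv P y then chain_meet P x y else chain_join P x y)"
  using prod_meet_or_join le_left_inv_iff by simp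

lemma prod_eq_right:
  "x \<in> carrier P \<Longrightarrow> y \<in> carrier P \<Longrightarrow>
    x \<bullet> y = (if y \<unlhd> right_inv P x then chain_meet P x y else chain_join P x y)"
  using prod_meet_or_join le_right_inv_iff by simp

text \<open>The two bracketings can differ only when \<open>x\<close> is not below \<open>y\<close>,
  \<open>y\<close> is not below \<open>z\<close>, and yet \<open>x \<lesssim> z\<close>.
  Transitivity then leaves \<open>y\<close> strictly comparable to neither \<open>x\<close> nor
  \<open>z\<close>, so both are its partner and they coincide.\<close>

lemma prod_assoc:
  assumes x: "x \<in> carrier P" and y: "y \<in> carrier P" and z: "z \<in> carrier P"
  shows "x \<bullet> y \<bullet> z = x \<bullet> (y \<bullet> z)"
proof -
  have "x = z" if h: "\<not> x \<lesssim> y" "\<not> y \<lesssim> z" "x \<lesssim> z"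
  proof (rule ccontr)
    assume ne: "x \<noteq> z"
    have "\<not> y \<prec> x" "\<not> z \<prec> y" "x \<noteq> y" "y \<noteq> z"
      using h rel_trans rel_refl x z unfolding emp_less_def by blast+
    then have yx: "is_partner P y x" and yz: "is_partner P y z"
      using h x z unfolding is_partner_def emp_less_def by auto
    then show False using partner_unique[OF y yx yz] ne by simp
  qed
  then show ?thesis unfolding prod_def using rel_trans[of x y z] by auto
qed

lemma le_meet_join_iff:
  assumes "w \<in> carrier P" "x \<in> carrier P" "y \<in> carrier P"
  shows "w \<unlhd> chain_meet P x y \<longleftrightarrow> w \<unlhd> x \<and> w \<unlhd> y"
    "chain_meet P x y \<unlhd> w \<longleftrightarrow> x \<unlhd> w \<or> y \<unlhd> w"
    "w \<unlhd> chain_join P x y \<longleftrightarrow> w \<unlhd> x \<or> w \<unlhd> y"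
    "chain_join P x y \<unlhd> w \<longleftrightarrow> x \<unlhd> w \<and> y \<unlhd> w"
  using le_total[of x y] le_trans[of w x y] le_trans[of w y x] le_trans[of x y w] le_trans[of y x w] assms
  unfolding chain_meet_def chain_join_def by auto

text \<open>Once \<open>\<bullet>\<close> is a meet or join according to
  \<open>y \<unlhd> right_inv P x\<close>, the rules for minima and maxima turn both sides into the
  same boolean function of the three comparisons \<open>x \<unlhd> z\<close>,
  \<open>y \<unlhd> z\<close> and \<open>y \<unlhd> right_inv P x\<close>.\<close>

lemma residual_right:
  assumes x: "x \<in> carrier P" and y: "y \<in> carrier P" and z: "z \<in> carrier P"
  shows "y \<unlhd> (if x \<unlhd> z then chain_join P (right_inv P x) z else chain_meet P (right_inv P x) z)
    \<longleftrightarrow> x \<bullet> y \<unlhd> z"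
  using x y z inv_closed(2)[OF x]
  unfolding prod_eq_right[OF x y] by (simp add: le_meet_join_iff)

lemma residual_left:
  assumes x: "x \<in> carrier P" and y: "y \<in> carrier P" and z: "z \<in> carrier P"
  shows "x \<unlhd> (if y \<unlhd> z then chain_join P (left_inv P y) z else chain_meet P (left_inv P y) z)
    \<longleftrightarrow> x \<bullet> y \<unlhd> z"
  using x y z inv_closed(1)[OF y]
  unfolding prod_eq_left[OF x y] by (simp add: le_meet_join_iff)

text \<open>With a partner present, the inverses are the partner and the star. The star is strictly
  comparable to \<open>x\<close>, hence in the same direction to the partner; as both lie in the
  part opposite to \<open>x\<close>, this puts the star below the partner in the chain
  order.\<close>

lemma star_meet:
  assumes x: "x \<in> carrier P"
  shows "chain_meet P (left_inv P x) (right_inv P x) = star P x"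
proof (cases "\<exists>y. is_partner P x y")
  case False
  then show ?thesis
    using left_inv_no_partner right_inv_no_partner by (simp add: chain_meet_def)
next
  case True
  then obtain y where y: "is_partner P x y" by blast
  note py = partner_cases[OF x y]
  have "star P x \<unlhd> y"
  proof (cases "x \<in> neg P")
    case True
    then show ?thesis
      using star_neg[OF True] py unfolding chain_le_def emp_less_def by blast
  next
    case False
    then have "x \<in> pos P" using x carrier_iff by blast
    then show ?thesis
      using star_pos[of x] py unfolding chain_le_def emp_less_def by blast
  qed
  then show ?thesis
    using left_inv_partner[OF x y] right_inv_partner[OF x y] le_antisym[of y "star P x"]
    by (auto simp: chain_meet_def)
qed

section \<open>The residuated chain \<open>A_of P\<close> and recovery of \<open>P\<close> from
  it\<close>

lemma A_of_simps:
  "carrier (A_of P) = carrier P" "\<one>\<^bsub>A_of P\<^esub> = eunit P"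
  "x \<in> carrier P \<Longrightarrow> y \<in> carrier P \<Longrightarrow> x \<otimes>\<^bsub>A_of P\<^esub> y = x \<bullet> y"
  "x \<in> carrier P \<Longrightarrow> y \<in> carrier P \<Longrightarrow> x \<^bold>\<and>\<^bsub>A_of P\<^esub> y = chain_meet P x y"
  "x \<in> carrier P \<Longrightarrow> y \<in> carrier P \<Longrightarrow> x \<^bold>\<or>\<^bsub>A_of P\<^esub> y = chain_join P x y"
  "x \<in> carrier P \<Longrightarrow> y \<in> carrier P \<Longrightarrow> ldiv (A_of P) x y =
    (if x \<unlhd> y then chain_join P (right_inv P x) y else chain_meet P (right_inv P x) y)"
  "x \<in> carrier P \<Longrightarrow> y \<in> carrier P \<Longrightarrow> rdiv (A_of P) y x =
    (if x \<unlhd> y then chain_join P (left_inv P x) y else chain_meet P (left_inv P x) y)"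
  unfolding A_of_def using prod_eq_left by simp_all

lemma A_of_le: "x \<in> carrier P \<Longrightarrow> y \<in> carrier P \<Longrightarrow> x \<preceq>\<^bsub>A_of P\<^esub> y \<longleftrightarrow> x \<unlhd> y"
  unfolding rl_le_def using A_of_simps le_refl le_total by (auto simp: chain_meet_def)

lemma meet_closed: "x \<in> carrier P \<Longrightarrow> y \<in> carrier P \<Longrightarrow> chain_meet P x y \<in> carrier P"
  and join_closed: "x \<in> carrier P \<Longrightarrow> y \<in> carrier P \<Longrightarrow> chain_join P x y \<in> carrier P"
  unfolding chain_meet_def chain_join_def by simp_all

lemma meet_assoc:
  assumes "x \<in> carrier P" "y \<in> carrier P" "z \<in> carrier P"
  shows "chain_meet P (chain_meet P x y) z = chain_meet P x (chain_meet P y z)"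
  using le_trans[of x y z] le_trans[of x z y] le_trans[of y x z] le_antisym[of x z]
    le_total[of x y] le_total[of y z] le_trans[of z y x] assms
  unfolding chain_meet_def by auto

lemma join_assoc:
  assumes "x \<in> carrier P" "y \<in> carrier P" "z \<in> carrier P"
  shows "chain_join P (chain_join P x y) z = chain_join P x (chain_join P y z)"
  using le_trans[of x y z] le_trans[of x z y] le_trans[of y x z] le_antisym[of x z]
    le_total[of x y] le_total[of y z] le_trans[of z y x] assms
  unfolding chain_join_def by auto

lemma A_of_chain: "idempotent_residuated_chain (A_of P)"
proof unfold_locales
  show "mult (A_of P) \<in> carrier (A_of P) \<rightarrow>\<^sub>E carrier (A_of P) \<rightarrow>\<^sub>E carrier (A_of P)"
    "rl_meet (A_of P) \<in> carrier (A_of P) \<rightarrow>\<^sub>E carrier (A_of P) \<rightarrow>\<^sub>E carrier (A_of P)"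
    "rl_join (A_of P) \<in> carrier (A_of P) \<rightarrow>\<^sub>E carrier (A_of P) \<rightarrow>\<^sub>E carrier (A_of P)"
    "ldiv (A_of P) \<in> carrier (A_of P) \<rightarrow>\<^sub>E carrier (A_of P) \<rightarrow>\<^sub>E carrier (A_of P)"
    "rdiv (A_of P) \<in> carrier (A_of P) \<rightarrow>\<^sub>E carrier (A_of P) \<rightarrow>\<^sub>E carrier (A_of P)"
    unfolding A_of_def using meet_closed join_closed inv_closed by (auto simp: PiE_def Pi_def)
next
  fix x y z
  assume "x \<in> carrier (A_of P)" "y \<in> carrier (A_of P)" "z \<in> carrier (A_of P)"
  then have c: "x \<in> carrier P" "y \<in> carrier P" "z \<in> carrier P" by (simp_all add: A_of_simps)
  show "x \<otimes>\<^bsub>A_of P\<^esub> y \<otimes>\<^bsub>A_of P\<^esub> z = x \<otimes>\<^bsub>A_of P\<^esub> (y \<otimes>\<^bsub>A_of P\<^esub> z)"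
    using c prod_assoc prod_closed by (simp add: A_of_simps)
  show "(x \<^bold>\<and>\<^bsub>A_of P\<^esub> y) \<^bold>\<and>\<^bsub>A_of P\<^esub> z = x \<^bold>\<and>\<^bsub>A_of P\<^esub> (y \<^bold>\<and>\<^bsub>A_of P\<^esub> z)"
    "(x \<^bold>\<or>\<^bsub>A_of P\<^esub> y) \<^bold>\<or>\<^bsub>A_of P\<^esub> z = x \<^bold>\<or>\<^bsub>A_of P\<^esub> (y \<^bold>\<or>\<^bsub>A_of P\<^esub> z)"
    using c by (simp_all add: A_of_simps meet_closed join_closed meet_assoc join_assoc)
  show "y \<preceq>\<^bsub>A_of P\<^esub> ldiv (A_of P) x z \<longleftrightarrow> x \<otimes>\<^bsub>A_of P\<^esub> y \<preceq>\<^bsub>A_of P\<^esub> z"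
    using c residual_right[OF c] by (simp add: A_of_simps A_of_le meet_closed join_closed inv_closed prod_closed)
  show "x \<otimes>\<^bsub>A_of P\<^esub> y \<preceq>\<^bsub>A_of P\<^esub> z \<longleftrightarrow> x \<preceq>\<^bsub>A_of P\<^esub> rdiv (A_of P) z y"
    using c residual_left[OF c] by (simp add: A_of_simps A_of_le meet_closed join_closed inv_closed prod_closed)
next
  fix x y
  assume "x \<in> carrier (A_of P)" "y \<in> carrier (A_of P)"
  then have c: "x \<in> carrier P" "y \<in> carrier P" by (simp_all add: A_of_simps)
  show "x \<otimes>\<^bsub>A_of P\<^esub> y \<in> carrier (A_of P)"
    using c by (simp add: A_of_simps prod_closed)
  show "x \<^bold>\<and>\<^bsub>A_of P\<^esub> y = y \<^bold>\<and>\<^bsub>A_of P\<^esub> x" "x \<^bold>\<or>\<^bsub>A_of P\<^esub> y = y \<^bold>\<or>\<^bsub>A_of P\<^esub> x"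
    "x \<^bold>\<and>\<^bsub>A_of P\<^esub> (x \<^bold>\<or>\<^bsub>A_of P\<^esub> y) = x" "x \<^bold>\<or>\<^bsub>A_of P\<^esub> (x \<^bold>\<and>\<^bsub>A_of P\<^esub> y) = x"
    using c le_total[OF c] le_antisym[of x y] le_refl
    by (simp_all add: A_of_simps meet_closed join_closed) (auto simp: chain_meet_def chain_join_def)
  show "x \<preceq>\<^bsub>A_of P\<^esub> y \<or> y \<preceq>\<^bsub>A_of P\<^esub> x"
    using c le_total by (simp add: A_of_le)
next
  fix x
  assume "x \<in> carrier (A_of P)"
  then have c: "x \<in> carrier P" by (simp add: A_of_simps)
  show "\<one>\<^bsub>A_of P\<^esub> \<otimes>\<^bsub>A_of P\<^esub> x = x" "x \<otimes>\<^bsub>A_of P\<^esub> \<one>\<^bsub>A_of P\<^esub> = x" "x \<otimes>\<^bsub>A_of P\<^esub> x = x"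
    using c unit_closed prod_unit by (simp_all add: A_of_simps) (simp add: prod_def)
next
  show "\<one>\<^bsub>A_of P\<^esub> \<in> carrier (A_of P)" by (simp add: A_of_simps unit_closed)
qed

text \<open>Dividing the unit by \<open>x\<close> yields the join of the inverse with the unit if
  \<open>x\<close> is negative and the meet otherwise. The inverse has the sign opposite to
  \<open>x\<close>, so the unit is absorbed.\<close>

lemma A_of_inv:
  assumes x: "x \<in> carrier P"
  shows "rdiv (A_of P) (eunit P) x = left_inv P x" "ldiv (A_of P) x (eunit P) = right_inv P x"
proof -
  have "left_inv P x \<in> pos P \<and> right_inv P x \<in> pos P" if "x \<unlhd> eunit P"
    using that inv_neg neg_iff x by blast
  moreover have "left_inv P x \<in> neg P \<and> right_inv P x \<in> neg P" if "\<not> x \<unlhd> eunit P"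
    using that inv_pos neg_iff x carrier_iff unit_neg by (metis DiffD1)
  ultimately show "rdiv (A_of P) (eunit P) x = left_inv P x"
    "ldiv (A_of P) x (eunit P) = right_inv P x"
    using x unit_closed neg_iff pos_iff inv_closed[OF x]
      le_antisym[of "eunit P" "left_inv P x"] le_antisym[of "eunit P" "right_inv P x"]
    by (auto simp: A_of_simps chain_meet_def chain_join_def)
qed

lemma P_of_A_of: "P_of (A_of P) = P"
proof -
  have "prel P = {(x, y). x \<in> carrier P \<and> y \<in> carrier P \<and> x \<otimes>\<^bsub>A_of P\<^esub> y = x}"
    using rel_closed rel_refl by (auto simp: A_of_simps prod_def emp_le_def split: if_splits)
  moreover have "pos P = {x \<in> carrier P. eunit P \<preceq>\<^bsub>A_of P\<^esub> x}"
    "neg P = {x \<in> carrier P. x \<preceq>\<^bsub>A_of P\<^esub> eunit P}"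
    using pos_iff neg_iff unit_closed carrier_iff by (auto simp: A_of_le)
  moreover have "star P =
      (\<lambda>x\<in>carrier P. rdiv (A_of P) (eunit P) x \<^bold>\<and>\<^bsub>A_of P\<^esub> ldiv (A_of P) x (eunit P))"
    \<comment> \<open>Off the carrier both functions are \<open>undefined\<close>, the left one by
      \<open>star_ext\<close>.\<close>
    using star_ext star_meet
    by (intro ext) (auto simp: A_of_inv A_of_simps inv_closed PiE_def extensional_def)
  ultimately show ?thesis
    unfolding P_of_def by (simp add: A_of_simps)
qed

end

section \<open>The preorder of an idempotent residuated chain\<close>

context residuated_lattice
begin

lemma meet_closed: "x \<in> carrier A \<Longrightarrow> y \<in> carrier A \<Longrightarrow> x \<^bold>\<and> y \<in> carrier A"
  and join_closed: "x \<in> carrier A \<Longrightarrow> y \<in> carrier A \<Longrightarrow> x \<^bold>\<or> y \<in> carrier A"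
  and ldiv_closed: "x \<in> carrier A \<Longrightarrow> y \<in> carrier A \<Longrightarrow> ldiv A x y \<in> carrier A"
  and rdiv_closed: "x \<in> carrier A \<Longrightarrow> y \<in> carrier A \<Longrightarrow> rdiv A x y \<in> carrier A"
  by (rule PiE_mem[OF PiE_mem[OF meet_ext]] PiE_mem[OF PiE_mem[OF join_ext]]
      PiE_mem[OF PiE_mem[OF ldiv_ext]] PiE_mem[OF PiE_mem[OF rdiv_ext]], assumption+)+

text \<open>Idempotence of the meet is derived from the two absorption laws.\<close>

lemma le_refl: "x \<in> carrier A \<Longrightarrow> x \<preceq> x"
  unfolding rl_le_def using meet_join_absorb[of x "x \<^bold>\<and> x"] join_meet_absorb[of x x] meet_closed[of x x]
  by simp

lemma le_antisym: "x \<in> carrier A \<Longrightarrow> y \<in> carrier A \<Longrightarrow> x \<preceq> y \<Longrightarrow> y \<preceq> x \<Longrightarrow> x = y"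
  unfolding rl_le_def using meet_comm[of x y] by simp

lemma le_trans:
  assumes "x \<in> carrier A" "y \<in> carrier A" "z \<in> carrier A" "x \<preceq> y" "y \<preceq> z"
  shows "x \<preceq> z"
  using assms meet_assoc[of x y z] unfolding rl_le_def by simp

lemma le_iff_join: "x \<in> carrier A \<Longrightarrow> y \<in> carrier A \<Longrightarrow> x \<preceq> y \<longleftrightarrow> x \<^bold>\<or> y = y"
  unfolding rl_le_def
  using meet_join_absorb[of x y] join_meet_absorb[of y x] meet_comm[of x y] join_comm[of x y] by auto

lemma le_meet_iff:
  assumes "x \<in> carrier A" "y \<in> carrier A" "z \<in> carrier A"
  shows "z \<preceq> x \<^bold>\<and> y \<longleftrightarrow> z \<preceq> x \<and> z \<preceq> y"
proof -
  have "x \<^bold>\<and> y \<preceq> x" "x \<^bold>\<and> y \<preceq> y"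
    using assms meet_comm[of x y] meet_assoc[of x x y] meet_assoc[of x y y] meet_assoc[of y x x]
      meet_assoc[of x y x] le_refl[of x] le_refl[of y] unfolding rl_le_def by simp_all
  moreover have "z \<preceq> x \<^bold>\<and> y" if "z \<preceq> x" "z \<preceq> y"
    using that assms meet_assoc[of z x y] unfolding rl_le_def by simp
  ultimately show ?thesis
    using assms le_trans meet_closed by blast
qed

lemma join_upper:
  assumes "x \<in> carrier A" "y \<in> carrier A"
  shows "x \<preceq> x \<^bold>\<or> y" "y \<preceq> x \<^bold>\<or> y"
  unfolding rl_le_def
  using assms meet_join_absorb[of x y] meet_join_absorb[of y x] join_comm[of x y] by simp_all

lemma join_least:
  assumes "x \<in> carrier A" "y \<in> carrier A" "z \<in> carrier A" "x \<preceq> z" "y \<preceq> z"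
  shows "x \<^bold>\<or> y \<preceq> z"
  using assms join_assoc[of x y z] join_closed by (simp add: le_iff_join)

lemma mult_left_mono:
  assumes "x \<in> carrier A" "y \<in> carrier A" "z \<in> carrier A" "x \<preceq> y"
  shows "z \<otimes> x \<preceq> z \<otimes> y"
  using assms ldiv_residual[of z x "z \<otimes> y"] ldiv_residual[of z y "z \<otimes> y"] le_refl[of "z \<otimes> y"]
    le_trans[of x y "ldiv A z (z \<otimes> y)"] ldiv_closed[of z "z \<otimes> y"] by simp

lemma mult_right_mono:
  assumes "x \<in> carrier A" "y \<in> carrier A" "z \<in> carrier A" "x \<preceq> y"
  shows "x \<otimes> z \<preceq> y \<otimes> z"
  using assms rdiv_residual[of x z "y \<otimes> z"] rdiv_residual[of y z "y \<otimes> z"] le_refl[of "y \<otimes> z"]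
    le_trans[of x y "rdiv A (y \<otimes> z) z"] rdiv_closed[of "y \<otimes> z" z] by simp

end

text \<open>Meets and divisions are determined by the elements below them, joins as least upper
  bounds. Extensionality of the operations settles the values off the carrier.\<close>

lemma residuated_lattice_eqI:
  fixes A B :: "'a residuated_lattice"
  assumes "residuated_lattice A" "residuated_lattice B"
    and carrier: "carrier A = carrier B" and one: "\<one>\<^bsub>A\<^esub> = \<one>\<^bsub>B\<^esub>"
    and mult: "\<And>x y. x \<in> carrier B \<Longrightarrow> y \<in> carrier B \<Longrightarrow> x \<otimes>\<^bsub>A\<^esub> y = x \<otimes>\<^bsub>B\<^esub> y"
    and le: "\<And>x y. x \<in> carrier B \<Longrightarrow> y \<in> carrier B \<Longrightarrow> x \<preceq>\<^bsub>A\<^esub> y \<longleftrightarrow> x \<preceq>\<^bsub>B\<^esub> y"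
  shows "A = B"
proof -
  interpret A: residuated_lattice A by fact
  interpret B: residuated_lattice B by fact
  have ext: "f = g" if f: "f \<in> carrier B \<rightarrow>\<^sub>E carrier B \<rightarrow>\<^sub>E carrier B"
    and g: "g \<in> carrier B \<rightarrow>\<^sub>E carrier B \<rightarrow>\<^sub>E carrier B"
    and eq: "\<And>x y. x \<in> carrier B \<Longrightarrow> y \<in> carrier B \<Longrightarrow> f x y = g x y" for f g
  proof (rule PiE_ext[OF f g])
    fix x
    assume x: "x \<in> carrier B"
    show "f x = g x"
      by (rule PiE_ext[OF PiE_mem[OF f x] PiE_mem[OF g x]]) (rule eq[OF x])
  qed
  \<comment> \<open>An element of a partial order is determined by its lower set.\<close>
  have eqI: "x = y" if "x \<in> carrier B" "y \<in> carrier B"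
    "\<And>z. z \<in> carrier B \<Longrightarrow> z \<preceq>\<^bsub>B\<^esub> x \<longleftrightarrow> z \<preceq>\<^bsub>B\<^esub> y" for x y
    using that B.le_antisym B.le_refl by blast
  have "mult A = mult B"
    using A.mult_ext B.mult_ext mult unfolding carrier by (intro ext) auto
  moreover have "rl_meet A = rl_meet B"
  proof (intro ext eqI)
    show "rl_meet A \<in> carrier B \<rightarrow>\<^sub>E carrier B \<rightarrow>\<^sub>E carrier B"
      "rl_meet B \<in> carrier B \<rightarrow>\<^sub>E carrier B \<rightarrow>\<^sub>E carrier B"
      using A.meet_ext B.meet_ext carrier by auto
  next
    fix x y
    assume "x \<in> carrier B" "y \<in> carrier B"
    then show "x \<^bold>\<and>\<^bsub>A\<^esub> y \<in> carrier B" "x \<^bold>\<and>\<^bsub>B\<^esub> y \<in> carrier B"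
      "\<And>z. z \<in> carrier B \<Longrightarrow> z \<preceq>\<^bsub>B\<^esub> x \<^bold>\<and>\<^bsub>A\<^esub> y \<longleftrightarrow> z \<preceq>\<^bsub>B\<^esub> x \<^bold>\<and>\<^bsub>B\<^esub> y"
      using A.meet_closed B.meet_closed A.le_meet_iff B.le_meet_iff le carrier by metis+
  qed
  moreover have "ldiv A = ldiv B"
  proof (intro ext eqI)
    show "ldiv A \<in> carrier B \<rightarrow>\<^sub>E carrier B \<rightarrow>\<^sub>E carrier B"
      "ldiv B \<in> carrier B \<rightarrow>\<^sub>E carrier B \<rightarrow>\<^sub>E carrier B"
      using A.ldiv_ext B.ldiv_ext carrier by auto
  next
    fix x y
    assume "x \<in> carrier B" "y \<in> carrier B"
    then show "ldiv A x y \<in> carrier B" "ldiv B x y \<in> carrier B"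
      "\<And>z. z \<in> carrier B \<Longrightarrow> z \<preceq>\<^bsub>B\<^esub> ldiv A x y \<longleftrightarrow> z \<preceq>\<^bsub>B\<^esub> ldiv B x y"
      using A.ldiv_closed B.ldiv_closed A.ldiv_residual B.ldiv_residual mult le carrier
        B.m_closed by metis+
  qed
  moreover have "rdiv A = rdiv B"
  proof (intro ext eqI)
    show "rdiv A \<in> carrier B \<rightarrow>\<^sub>E carrier B \<rightarrow>\<^sub>E carrier B"
      "rdiv B \<in> carrier B \<rightarrow>\<^sub>E carrier B \<rightarrow>\<^sub>E carrier B"
      using A.rdiv_ext B.rdiv_ext carrier by auto
  next
    fix x y
    assume "x \<in> carrier B" "y \<in> carrier B"
    then show "rdiv A x y \<in> carrier B" "rdiv B x y \<in> carrier B"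
      "\<And>z. z \<in> carrier B \<Longrightarrow> z \<preceq>\<^bsub>B\<^esub> rdiv A x y \<longleftrightarrow> z \<preceq>\<^bsub>B\<^esub> rdiv B x y"
      using A.rdiv_closed B.rdiv_closed A.rdiv_residual B.rdiv_residual mult le carrier
        B.m_closed by metis+
  qed
  moreover have "rl_join A = rl_join B"
  proof (intro ext)
    show "rl_join A \<in> carrier B \<rightarrow>\<^sub>E carrier B \<rightarrow>\<^sub>E carrier B"
      "rl_join B \<in> carrier B \<rightarrow>\<^sub>E carrier B \<rightarrow>\<^sub>E carrier B"
      using A.join_ext B.join_ext carrier by auto
  next
    fix x y
    assume xy: "x \<in> carrier B" "y \<in> carrier B"
    \<comment> \<open>A join is described from above rather than by its lower set, so each of the
      two joins is compared with the other as an upper bound.\<close>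
    have "x \<^bold>\<or>\<^bsub>A\<^esub> y \<preceq>\<^bsub>A\<^esub> x \<^bold>\<or>\<^bsub>B\<^esub> y" "x \<^bold>\<or>\<^bsub>B\<^esub> y \<preceq>\<^bsub>B\<^esub> x \<^bold>\<or>\<^bsub>A\<^esub> y"
      using xy le carrier A.join_closed B.join_closed A.join_least B.join_least
        A.join_upper B.join_upper by metis+
    then show "x \<^bold>\<or>\<^bsub>A\<^esub> y = x \<^bold>\<or>\<^bsub>B\<^esub> y"
      using xy le carrier A.join_closed B.join_closed B.le_antisym by metis
  qed
  ultimately show ?thesis
    using carrier one by simp
qed

section \<open>Multiplication in an idempotent residuated chain\<close>

locale chain_to_preorder = idempotent_residuated_chain A for A :: "'a residuated_lattice" (structure)
begin

text \<open>Monotonicity and idempotency squeeze the product: \<open>x = x \<otimes> x \<preceq> x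
  \<otimes> y \<preceq> x \<otimes> \<one> = x\<close>, and likewise on the other side.\<close>

lemma mult_neg:
  assumes "x \<in> carrier A" "y \<in> carrier A" "x \<preceq> \<one>" "y \<preceq> \<one>" "x \<preceq> y"
  shows "x \<otimes> y = x" "y \<otimes> x = x"
  using assms mult_left_mono[of y \<one> x] mult_left_mono[of x y x] mult_right_mono[of y \<one> x]
    mult_right_mono[of x y x] mult_idem[of x] le_antisym[of "x \<otimes> y" x] le_antisym[of "y \<otimes> x" x]
  by simp_all

lemma mult_pos:
  assumes "x \<in> carrier A" "y \<in> carrier A" "\<one> \<preceq> x" "\<one> \<preceq> y" "x \<preceq> y"
  shows "x \<otimes> y = y" "y \<otimes> x = y"
  using assms mult_left_mono[of \<one> x y] mult_left_mono[of x y y] mult_right_mono[of \<one> x y]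
    mult_right_mono[of x y y] mult_idem[of y] le_antisym[of "x \<otimes> y" y] le_antisym[of "y \<otimes> x" y]
  by simp_all

lemma mult_comm_neg: "x \<in> carrier A \<Longrightarrow> y \<in> carrier A \<Longrightarrow> x \<preceq> \<one> \<Longrightarrow> y \<preceq> \<one> \<Longrightarrow> x \<otimes> y = y \<otimes> x"
  using le_total mult_neg by metis

lemma mult_comm_pos: "x \<in> carrier A \<Longrightarrow> y \<in> carrier A \<Longrightarrow> \<one> \<preceq> x \<Longrightarrow> \<one> \<preceq> y \<Longrightarrow> x \<otimes> y = y \<otimes> x"
  using le_total mult_pos by metis

text \<open>
  For \<open>x \<preceq> \<one> \<preceq> y\<close> the product lies between \<open>x\<close> and \<open>y\<close>. Multiplying it by the factor on its own
  side of \<open>\<one>\<close> leaves it unchanged by idempotency, but gives that factor since the two are comparable.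
\<close>

lemma mult_mixed:
  assumes x: "x \<in> carrier A" "x \<preceq> \<one>" and y: "y \<in> carrier A" "\<one> \<preceq> y"
  shows "x \<otimes> y = (if x \<otimes> y \<preceq> \<one> then x else y)" "y \<otimes> x = (if y \<otimes> x \<preceq> \<one> then x else y)"
proof -
  have b: "x \<preceq> x \<otimes> y" "x \<preceq> y \<otimes> x" "x \<otimes> y \<preceq> y" "y \<otimes> x \<preceq> y"
    using mult_left_mono[of \<one> y x] mult_right_mono[of \<one> y x] mult_left_mono[of x \<one> y]
      mult_right_mono[of x \<one> y] x y by simp_all
  have c: "x \<otimes> y \<in> carrier A" "y \<otimes> x \<in> carrier A" using x y by auto
  have i: "x \<otimes> (x \<otimes> y) = x \<otimes> y" "(x \<otimes> y) \<otimes> y = x \<otimes> y" "(y \<otimes> x) \<otimes> x = y \<otimes> x" "y \<otimes> (y \<otimes> x) = y \<otimes> x"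
    using x y mult_idem m_assoc by (metis m_assoc)+
  show "x \<otimes> y = (if x \<otimes> y \<preceq> \<one> then x else y)"
    using le_total[OF c(1) one_closed] mult_neg(1)[OF x(1) c(1) x(2) _ b(1)] mult_pos(1)[OF c(1) y(1) _ y(2) b(3)] i
    by auto
  show "y \<otimes> x = (if y \<otimes> x \<preceq> \<one> then x else y)"
    using le_total[OF c(2) one_closed] mult_neg(2)[OF x(1) c(2) x(2) _ b(2)] mult_pos(2)[OF c(2) y(1) _ y(2) b(4)] i
    by auto
qed

lemma mult_cases:
  assumes "x \<in> carrier A" "y \<in> carrier A"
  shows "x \<otimes> y = x \<or> x \<otimes> y = y"
  using assms le_total[of x \<one>] le_total[of y \<one>] le_total[of x y] mult_neg mult_pos mult_mixed
  by (metis one_closed)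

section \<open>The star operation and the relation of \<open>P_of A\<close>\<close>

abbreviation meet_inverse :: "'a \<Rightarrow> 'a" where "meet_inverse x \<equiv> rdiv A \<one> x \<^bold>\<and> ldiv A x \<one>"

lemma inverse_closed: "x \<in> carrier A \<Longrightarrow> meet_inverse x \<in> carrier A"
  using meet_closed ldiv_closed rdiv_closed by simp

text \<open>Exhibits \<open>meet_inverse x\<close> as the largest element whose products with
  \<open>x\<close> on both sides are below the unit. The extremal properties of the star rest on
  this.\<close>

lemma le_inverse_iff:
  assumes "x \<in> carrier A" "y \<in> carrier A"
  shows "y \<preceq> meet_inverse x \<longleftrightarrow> y \<otimes> x \<preceq> \<one> \<and> x \<otimes> y \<preceq> \<one>"
  using assms le_meet_iff[of "rdiv A \<one> x" "ldiv A x \<one>" y] ldiv_closed rdiv_closed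
    ldiv_residual[of x y \<one>] rdiv_residual[of y x \<one>] by simp

lemma P_of_simps:
  "carrier (P_of A) = carrier A" "eunit (P_of A) = \<one>"
  "pos (P_of A) = {x \<in> carrier A. \<one> \<preceq> x}" "neg (P_of A) = {x \<in> carrier A. x \<preceq> \<one>}"
  "prel (P_of A) = {(x, y). x \<in> carrier A \<and> y \<in> carrier A \<and> x \<otimes> y = x}"
  "x \<lesssim>\<^bsub>P_of A\<^esub> y \<longleftrightarrow> x \<in> carrier A \<and> y \<in> carrier A \<and> x \<otimes> y = x"
  "x \<prec>\<^bsub>P_of A\<^esub> y \<longleftrightarrow> x \<in> carrier A \<and> y \<in> carrier A \<and> x \<otimes> y = x \<and> y \<otimes> x \<noteq> y"
  "star (P_of A) = (\<lambda>x\<in>carrier A. meet_inverse x)"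
  unfolding P_of_def emp_le_def emp_less_def by auto

text \<open>A product is one of its factors, so \<open>y \<otimes> x \<noteq> y\<close> forces
  \<open>y \<otimes> x = x\<close>. Strict comparability of distinct elements thus amounts to
  commuting.\<close>

lemma less_iff:
  assumes "x \<in> carrier A" "y \<in> carrier A"
  shows "x \<prec>\<^bsub>P_of A\<^esub> y \<longleftrightarrow> x \<noteq> y \<and> x \<otimes> y = x \<and> y \<otimes> x = x"
  using assms mult_cases[of y x] mult_idem by (auto simp: P_of_simps)

lemma rel_trans:
  assumes "x \<in> carrier A" "y \<in> carrier A" "z \<in> carrier A" "x \<otimes> y = x" "y \<otimes> z = y"
  shows "x \<otimes> z = x"
  using assms m_assoc[of x y z] by simp

text \<open>The products of \<open>b\<close> with its inverse are below the unit, so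
  \<open>mult_mixed\<close> makes them equal to \<open>b\<close>. A positive \<open>c\<close>
  strictly above \<open>b\<close> has both products with \<open>b\<close> equal to \<open>b\<close>,
  hence lies below the inverse in the chain order, which is reversed by \<open>\<lesssim>\<close> on
  the positive part.\<close>

lemma inverse_neg:
  assumes b: "b \<in> carrier A" "b \<preceq> \<one>" "b \<noteq> \<one>"
  shows "\<one> \<preceq> meet_inverse b" "b \<prec>\<^bsub>P_of A\<^esub> meet_inverse b"
    "\<lbrakk>c \<in> carrier A; \<one> \<preceq> c; b \<prec>\<^bsub>P_of A\<^esub> c\<rbrakk> \<Longrightarrow> meet_inverse b \<otimes> c = meet_inverse b"
proof -
  note s = inverse_closed[OF b(1)]
  show p: "\<one> \<preceq> meet_inverse b" using b le_inverse_iff by simp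
  have l: "meet_inverse b \<otimes> b \<preceq> \<one>" "b \<otimes> meet_inverse b \<preceq> \<one>"
    using le_inverse_iff[OF b(1) s] le_refl[OF s] by auto
  have e: "b \<otimes> meet_inverse b = b" "meet_inverse b \<otimes> b = b"
    by (rule trans[OF mult_mixed(1)[OF b(1,2) s p]] trans[OF mult_mixed(2)[OF b(1,2) s p]],
        simp add: l)+
  have "b \<noteq> meet_inverse b" using p b le_antisym[OF b(1) one_closed] by auto
  then show "b \<prec>\<^bsub>P_of A\<^esub> meet_inverse b" using e less_iff[OF b(1) s] by simp
  assume c: "c \<in> carrier A" "\<one> \<preceq> c" "b \<prec>\<^bsub>P_of A\<^esub> c"
  then have "c \<preceq> meet_inverse b" using b le_inverse_iff[OF b(1) c(1)] less_iff[OF b(1) c(1)] by simp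
  then show "meet_inverse b \<otimes> c = meet_inverse b" by (rule mult_pos(2)[OF c(1) s c(2) p])
qed

text \<open>The sign of the inverse comes out of the computation: the products with \<open>a\<close>
  are below the unit while \<open>a\<close> is not, so by \<open>mult_cases\<close> they equal the
  inverse, which is therefore below the unit itself.\<close>

lemma inverse_pos:
  assumes a: "a \<in> carrier A" "\<one> \<preceq> a" "a \<noteq> \<one>"
  shows "meet_inverse a \<preceq> \<one>" "meet_inverse a \<prec>\<^bsub>P_of A\<^esub> a"
    "\<lbrakk>c \<in> carrier A; c \<preceq> \<one>; c \<prec>\<^bsub>P_of A\<^esub> a\<rbrakk> \<Longrightarrow> c \<otimes> meet_inverse a = c"
proof -
  note s = inverse_closed[OF a(1)]
  have na: "\<not> a \<preceq> \<one>" using a le_antisym[of a \<one>] by auto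
  have l: "meet_inverse a \<otimes> a \<preceq> \<one>" "a \<otimes> meet_inverse a \<preceq> \<one>"
    using le_inverse_iff[OF a(1) s] le_refl[OF s] by auto
  then have e: "meet_inverse a \<otimes> a = meet_inverse a" "a \<otimes> meet_inverse a = meet_inverse a"
    using na mult_cases[OF a(1) s] mult_cases[OF s a(1)] by auto
  then show p: "meet_inverse a \<preceq> \<one>" using l by simp
  then show "meet_inverse a \<prec>\<^bsub>P_of A\<^esub> a"
    using e na less_iff[OF s a(1)] by auto
  assume c: "c \<in> carrier A" "c \<preceq> \<one>" "c \<prec>\<^bsub>P_of A\<^esub> a"
  then have "c \<preceq> meet_inverse a" using le_inverse_iff[OF a(1) c(1)] less_iff[OF c(1) a(1)] by simp
  then show "c \<otimes> meet_inverse a = c" by (rule mult_neg(1)[OF c(1) s c(2) p])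
qed

lemma inverse_one: "meet_inverse \<one> = \<one>"
proof -
  note s = inverse_closed[OF one_closed]
  show ?thesis
    using le_inverse_iff[OF one_closed s] le_inverse_iff[OF one_closed one_closed] s
      le_refl[OF s] le_refl[OF one_closed] le_antisym[OF s one_closed] by simp
qed

text \<open>The elements \<open>x\<close> and \<open>y\<close> form a left-zero or a right-zero
  pair. On one side associativity carries the absorption with \<open>z\<close> over from
  \<open>x\<close> to \<open>y\<close>; on the other side the wrong alternative of
  \<open>mult_cases\<close> would give \<open>z = x\<close>.\<close>

lemma unrelated_P_of:
  assumes x: "x \<in> carrier A" and y: "y \<in> carrier A" and z: "z \<in> carrier A"
    and ne: "x \<noteq> y" and nx: "\<not> x \<prec>\<^bsub>P_of A\<^esub> y" and ny: "\<not> y \<prec>\<^bsub>P_of A\<^esub> x"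
  shows "z \<prec>\<^bsub>P_of A\<^esub> x \<Longrightarrow> z \<prec>\<^bsub>P_of A\<^esub> y" "x \<prec>\<^bsub>P_of A\<^esub> z \<Longrightarrow> y \<prec>\<^bsub>P_of A\<^esub> z"
proof -
  consider "x \<otimes> y = x" "y \<otimes> x = y" | "x \<otimes> y = y" "y \<otimes> x = x"
    using ne nx ny less_iff[OF x y] less_iff[OF y x] mult_cases[OF x y] mult_cases[OF y x] by auto
  note xy = this
  note assoc = m_assoc[OF x y z] m_assoc[OF y x z] m_assoc[OF z x y] m_assoc[OF z y x]
    m_assoc[OF x z y] m_assoc[OF y z x]
  note c = mult_cases[OF x z] mult_cases[OF z x] mult_cases[OF y z] mult_cases[OF z y]
  show "z \<prec>\<^bsub>P_of A\<^esub> x \<Longrightarrow> z \<prec>\<^bsub>P_of A\<^esub> y"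
    using xy assoc c ne nx ny unfolding less_iff[OF z x] less_iff[OF z y] less_iff[OF x y] less_iff[OF y x]
    by metis
  show "x \<prec>\<^bsub>P_of A\<^esub> z \<Longrightarrow> y \<prec>\<^bsub>P_of A\<^esub> z"
    using xy assoc c ne nx ny unfolding less_iff[OF x z] less_iff[OF y z] less_iff[OF x y] less_iff[OF y x]
    by metis
qed

lemma P_of_preorder: "enhanced_monoidal_preorder (P_of A)"
proof
  show "preorder_on (carrier (P_of A)) (prel (P_of A))"
    using mult_idem by (auto simp: preorder_on_def refl_on_def P_of_simps intro!: transI intro: rel_trans)
  show "eunit (P_of A) \<in> carrier (P_of A)" by (simp add: P_of_simps)
  show "x \<prec>\<^bsub>P_of A\<^esub> eunit (P_of A)"
    if "x \<in> carrier (P_of A)" "x \<noteq> eunit (P_of A)" for x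
    using that by (simp add: P_of_simps)
  show "linear_order_on (pos (P_of A)) (Restr (prel (P_of A)) (pos (P_of A)))"
    unfolding linear_order_on_def partial_order_on_def preorder_on_def
  proof (intro conjI)
    let ?r = "Restr (prel (P_of A)) (pos (P_of A))"
    show "?r \<subseteq> pos (P_of A) \<times> pos (P_of A)" by blast
    show "refl_on (pos (P_of A)) ?r"
      using mult_idem by (auto simp: refl_on_def P_of_simps)
    show "trans ?r"
      by (rule transI) (auto simp: P_of_simps intro: rel_trans)
    \<comment> \<open>The positive part is commutative, which gives
      \<open>x = x \<otimes> y = y \<otimes> x = y\<close>; totality follows in the same way from
      \<open>mult_cases\<close>.\<close>
    show "antisym ?r"
    proof (rule antisymI)
      fix x y
      assume "(x, y) \<in> ?r" "(y, x) \<in> ?r"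
      then show "x = y"
        using mult_comm_pos[of x y] by (simp add: P_of_simps)
    qed
    show "total_on (pos (P_of A)) ?r"
    proof (rule total_onI)
      fix x y
      assume "x \<in> pos (P_of A)" "y \<in> pos (P_of A)"
      then show "(x, y) \<in> ?r \<or> (y, x) \<in> ?r"
        using mult_comm_pos[of x y] mult_cases[of x y] by (auto simp: P_of_simps)
    qed
  qed
  show "linear_order_on (neg (P_of A)) (Restr (prel (P_of A)) (neg (P_of A)))"
    unfolding linear_order_on_def partial_order_on_def preorder_on_def
  proof (intro conjI)
    let ?r = "Restr (prel (P_of A)) (neg (P_of A))"
    show "?r \<subseteq> neg (P_of A) \<times> neg (P_of A)" by blast
    show "refl_on (neg (P_of A)) ?r"
      using mult_idem by (auto simp: refl_on_def P_of_simps)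
    show "trans ?r"
      by (rule transI) (auto simp: P_of_simps intro: rel_trans)
    show "antisym ?r"
    proof (rule antisymI)
      fix x y
      assume "(x, y) \<in> ?r" "(y, x) \<in> ?r"
      then show "x = y"
        using mult_comm_neg[of x y] by (simp add: P_of_simps)
    qed
    show "total_on (neg (P_of A)) ?r"
    proof (rule total_onI)
      fix x y
      assume "x \<in> neg (P_of A)" "y \<in> neg (P_of A)"
      then show "(x, y) \<in> ?r \<or> (y, x) \<in> ?r"
        using mult_comm_neg[of x y] mult_cases[of x y] by (auto simp: P_of_simps)
    qed
  qed
  show "pos (P_of A) \<union> neg (P_of A) = carrier (P_of A)"
    using le_total by (auto simp: P_of_simps)
  show "pos (P_of A) \<inter> neg (P_of A) = {eunit (P_of A)}"
    using le_antisym le_refl by (auto simp: P_of_simps)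
  show "star (P_of A) \<in> carrier (P_of A) \<rightarrow>\<^sub>E carrier (P_of A)"
    using inverse_closed by (auto simp: P_of_simps)
  show "star (P_of A) (eunit (P_of A)) = eunit (P_of A)"
    using inverse_one by (simp add: P_of_simps)
next
  fix b
  assume "b \<in> neg (P_of A)" "b \<noteq> eunit (P_of A)"
  then have b: "b \<in> carrier A" "b \<preceq> \<one>" "b \<noteq> \<one>" by (simp_all add: P_of_simps)
  show "star (P_of A) b \<in> pos (P_of A) \<and> b \<prec>\<^bsub>P_of A\<^esub> star (P_of A) b \<and>
      (\<forall>c\<in>pos (P_of A). b \<prec>\<^bsub>P_of A\<^esub> c \<longrightarrow> star (P_of A) b \<lesssim>\<^bsub>P_of A\<^esub> c)"
    using inverse_neg[OF b] inverse_closed[OF b(1)] b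
    by (auto simp: P_of_simps(1-4,6,8))
next
  fix a
  assume "a \<in> pos (P_of A)" "a \<noteq> eunit (P_of A)"
  then have a: "a \<in> carrier A" "\<one> \<preceq> a" "a \<noteq> \<one>" by (simp_all add: P_of_simps)
  show "star (P_of A) a \<in> neg (P_of A) \<and> star (P_of A) a \<prec>\<^bsub>P_of A\<^esub> a \<and>
      (\<forall>c\<in>neg (P_of A). c \<prec>\<^bsub>P_of A\<^esub> a \<longrightarrow> c \<lesssim>\<^bsub>P_of A\<^esub> star (P_of A) a)"
    using inverse_pos[OF a] inverse_closed[OF a(1)] a
    by (auto simp: P_of_simps(1-4,6,8))
next
  fix x y
  assume "x \<in> carrier (P_of A)" "y \<in> carrier (P_of A)"
    and u: "x \<noteq> y" "\<not> x \<prec>\<^bsub>P_of A\<^esub> y" "\<not> y \<prec>\<^bsub>P_of A\<^esub> x"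
  then have c: "x \<in> carrier A" "y \<in> carrier A" by (simp_all add: P_of_simps)
  \<comment> \<open>Elements that are not strictly comparable do not commute, whereas each part is
    commutative; hence they lie in opposite parts.\<close>
  have "x \<otimes> y \<noteq> y \<otimes> x"
    using u less_iff[OF c] less_iff[OF c(2,1)] mult_cases[OF c] by auto
  then have "x \<in> pos (P_of A) \<and> y \<in> neg (P_of A) \<or> x \<in> neg (P_of A) \<and> y \<in> pos (P_of A)"
    using mult_comm_neg[OF c] mult_comm_pos[OF c] le_total[OF c(1) one_closed]
      le_total[OF c(2) one_closed] c by (auto simp: P_of_simps)
  then show "(x \<in> pos (P_of A) \<and> y \<in> neg (P_of A) \<or> x \<in> neg (P_of A) \<and> y \<in> pos (P_of A)) \<and>
      {z \<in> carrier (P_of A). z \<prec>\<^bsub>P_of A\<^esub> x} = {z \<in> carrier (P_of A). z \<prec>\<^bsub>P_of A\<^esub> y} \<and>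
      {z \<in> carrier (P_of A). x \<prec>\<^bsub>P_of A\<^esub> z} = {z \<in> carrier (P_of A). y \<prec>\<^bsub>P_of A\<^esub> z}"
    using unrelated_P_of[OF c _ u] unrelated_P_of[OF c(2,1) _ u(1)[symmetric] u(3,2)]
    unfolding P_of_simps(1) by blast
qed

text \<open>Products are minima on the negative part and maxima on the positive part, so the
  relation encodes the order there; across the parts the order passes through the unit. A positive
  element below a negative one is the unit, as is the other.\<close>

lemma chain_le_P_of:
  assumes c: "x \<in> carrier A" "y \<in> carrier A"
  shows "chain_le (P_of A) x y \<longleftrightarrow> x \<preceq> y"
proof -
  have neg: "x \<otimes> y = x \<longleftrightarrow> x \<preceq> y" if "x \<preceq> \<one>" "y \<preceq> \<one>"
    using that c mult_neg[of x y] mult_neg[of y x] le_total[OF c] le_refl by auto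
  have pos: "y \<otimes> x = y \<longleftrightarrow> x \<preceq> y" if "\<one> \<preceq> x" "\<one> \<preceq> y"
    using that c mult_pos[of x y] mult_pos[of y x] le_total[OF c] le_refl by auto
  have mixed: "x \<preceq> y" if "x \<preceq> \<one>" "\<one> \<preceq> y"
    using that c le_trans[of x \<one> y] by simp
  have "x = \<one> \<and> y = \<one>" if "\<one> \<preceq> x" "y \<preceq> \<one>" "x \<preceq> y"
    using that c le_trans[of \<one> x y] le_trans[of x y \<one>] le_antisym[of x \<one>] le_antisym[of y \<one>] by simp
  then show ?thesis
    using neg pos mixed le_total[OF c(1) one_closed] le_total[OF c(2) one_closed] c
    unfolding chain_le_def by (auto simp: P_of_simps)
qed

lemma A_of_P_of: "A_of (P_of A) = A"
proof -
  interpret P: enhanced_monoidal_preorder "P_of A" by (fact P_of_preorder)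
  interpret P: preorder_to_chain "P_of A" by unfold_locales
  interpret B: idempotent_residuated_chain "A_of (P_of A)" by (fact P.A_of_chain)
  show ?thesis
  proof (rule residuated_lattice_eqI)
    show "residuated_lattice (A_of (P_of A))" "residuated_lattice A"
      by unfold_locales
    show "carrier (A_of (P_of A)) = carrier A" "\<one>\<^bsub>A_of (P_of A)\<^esub> = \<one>"
      by (simp_all add: P.A_of_simps P_of_simps)
  next
    fix x y
    assume c: "x \<in> carrier A" "y \<in> carrier A"
    then show "x \<otimes>\<^bsub>A_of (P_of A)\<^esub> y = x \<otimes> y"
      \<comment> \<open>\<open>P.prod\<close> returns \<open>x\<close> if
        \<open>x \<otimes> y = x\<close> and \<open>y\<close> otherwise, and in the latter case
        \<open>mult_cases\<close> gives \<open>x \<otimes> y = y\<close>.\<close>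
      using mult_cases[OF c] by (auto simp: P.A_of_simps P_of_simps P.prod_def)
    have "x \<preceq>\<^bsub>A_of (P_of A)\<^esub> y \<longleftrightarrow> chain_le (P_of A) x y"
      using c by (simp add: P.A_of_le P_of_simps)
    also have "\<dots> \<longleftrightarrow> x \<preceq> y"
      using c chain_le_P_of by simp
    finally show "x \<preceq>\<^bsub>A_of (P_of A)\<^esub> y \<longleftrightarrow> x \<preceq> y" .
  qed
qed

end

theorem corollary4p13:
  shows "(\<forall>A :: 'a residuated_lattice. idempotent_residuated_chain A \<longrightarrow>
            enhanced_monoidal_preorder (P_of A) \<and> A_of (P_of A) = A) \<and>
         (\<forall>P :: 'a enhanced_preorder. enhanced_monoidal_preorder P \<longrightarrow>
            idempotent_residuated_chain (A_of P) \<and> P_of (A_of P) = P)"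
  \<comment> \<open>The two working locales add no assumptions, so unfolding them leaves the
    predicates of the statement.\<close>
  using chain_to_preorder.P_of_preorder chain_to_preorder.A_of_P_of
    preorder_to_chain.A_of_chain preorder_to_chain.P_of_A_of
  unfolding chain_to_preorder_def preorder_to_chain_def by blast

end
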